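(* For any graphs $G$ and $H$, $\rho_e^o(G\circ H)\le \min\{\rho_e^o(G\boxtimes H),\ \rho_e^o(G\,\square\, H)\}$.
   Context: All graphs are finite and simple. A set $B\subseteq E(G)$ is an edge open packing set (EOP set) of $G$ if for any two distinct edges $e_1,e_2\in B$ there is no edge $e\in E(G)\setminus\{e_1,e_2\}$ joining an endvertex of $e_1$ to an endvertex of $e_2$ (that is, no edge $e$ such that $e_1,e,e_2$ form a path with middle edge $e$ or a triangle). Edges of $B$ may share an endvertex. The maximum cardinality of an EOP set is the EOP number $\rho_e^o(G)$. The following products of $G$ and $H$ all have vertex set $V(G)\times V(H)$. In the Cartesian product $G\,\square\,H$ two vertices are adjacent if they are adjacent in one coordinate and equal in the other. In the direct product $G\times H$ two vertices are adjacent if they are adjacent in both coordinates. The edge set of the strong product $G\boxtimes H$ is $E(G\,\square\,H)\cup E(G\times H)$. In the lexicographic product $G\circ H$, $(g,h)$ and $(g',h')$ are adjacent if either $gg'\in E(G)$, or $g=g'$ and $hh'\in E(H)$. *)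

theory Defs
  imports "Graph_Theory.Pair_Digraph"
begin

text \<open>
  A finite simple graph is a digraph without parallel arcs that satisfies the locale
  \<^locale>\<open>pair_graph\<close>: finite, symmetric and loop-free.  Every edge is thus represented
  by two arcs; since edge open packings are counted in edges, an edge is taken to be
  the two-element set of its endvertices.
\<close>

definition uedges :: "'a pair_pre_digraph \<Rightarrow> 'a set set" where
  "uedges G = {{u, v} | u v. (u, v) \<in> parcs G}"

definition cartesian_product ::
  "'a pair_pre_digraph \<Rightarrow> 'b pair_pre_digraph \<Rightarrow> ('a \<times> 'b) pair_pre_digraph" where
  "cartesian_product G H =
    \<lparr> pverts = pverts G \<times> pverts H,
      parcs = {((g, h), (g', h')) | g h g' h'.
        (g, g') \<in> parcs G \<and> h = h' \<and> h \<in> pverts H \<or>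
        g = g' \<and> g \<in> pverts G \<and> (h, h') \<in> parcs H} \<rparr>"

definition direct_product ::
  "'a pair_pre_digraph \<Rightarrow> 'b pair_pre_digraph \<Rightarrow> ('a \<times> 'b) pair_pre_digraph" where
  "direct_product G H =
    \<lparr> pverts = pverts G \<times> pverts H,
      parcs = {((g, h), (g', h')) | g h g' h'. (g, g') \<in> parcs G \<and> (h, h') \<in> parcs H} \<rparr>"

definition strong_product ::
  "'a pair_pre_digraph \<Rightarrow> 'b pair_pre_digraph \<Rightarrow> ('a \<times> 'b) pair_pre_digraph" where
  "strong_product G H =
    \<lparr> pverts = pverts G \<times> pverts H,
      parcs = parcs (cartesian_product G H) \<union> parcs (direct_product G H) \<rparr>"

definition lexicographic_product ::
  "'a pair_pre_digraph \<Rightarrow> 'b pair_pre_digraph \<Rightarrow> ('a \<times> 'b) pair_pre_digraph" where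
  "lexicographic_product G H =
    \<lparr> pverts = pverts G \<times> pverts H,
      parcs = {((g, h), (g', h')) | g h g' h'.
        (g, g') \<in> parcs G \<and> h \<in> pverts H \<and> h' \<in> pverts H \<or>
        g = g' \<and> g \<in> pverts G \<and> (h, h') \<in> parcs H} \<rparr>"

text \<open>
  Edges of an edge open packing may share an endvertex.  The joining edge \<open>e\<close> ranges over all
  edges of \<open>G\<close> other than \<open>e\<^sub>1\<close> and \<open>e\<^sub>2\<close>, members of \<open>B\<close> included, so both
  a path with middle edge \<open>e\<close> and a triangle are excluded.
\<close>

definition edge_open_packing :: "'a pair_pre_digraph \<Rightarrow> 'a set set \<Rightarrow> bool" where
  "edge_open_packing G B \<longleftrightarrow> B \<subseteq> uedges G \<and>
    (\<forall>e\<^sub>1\<in>B. \<forall>e\<^sub>2\<in>B. e\<^sub>1 \<noteq> e\<^sub>2 \<longrightarrow>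
      \<not> (\<exists>e\<in>uedges G - {e\<^sub>1, e\<^sub>2}. \<exists>u\<in>e\<^sub>1. \<exists>v\<in>e\<^sub>2. e = {u, v}))"

definition eop_number :: "'a pair_pre_digraph \<Rightarrow> nat" where
  "eop_number G = Max {card B | B. edge_open_packing G B}"

lemma finite_uedges:
  assumes "pair_graph G"
  shows "finite (uedges G)"
proof -
  interpret pair_graph G by (rule assms)
  have "uedges G = (\<lambda>(u, v). {u, v}) ` parcs G"
    unfolding uedges_def by auto
  then show ?thesis using pair_finite_arcs by simp
qed

lemma finite_eop_cards:
  assumes "pair_graph G"
  shows "finite {card B | B. edge_open_packing G B}"
proof -
  have "{card B | B. edge_open_packing G B} \<subseteq> card ` Pow (uedges G)"
    unfolding edge_open_packing_def by auto
  then show ?thesis using finite_uedges[OF assms] by (meson finite_Pow_iff finite_imageI finite_subset)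
qed

lemma eop_cards_nonempty: "{card B | B. edge_open_packing G B} \<noteq> {}"
proof -
  have "edge_open_packing G {}" unfolding edge_open_packing_def by simp
  then show ?thesis by blast
qed

lemma pair_graphI:
  assumes "finite (pverts G)"
    and "\<And>u v. (u, v) \<in> parcs G \<Longrightarrow> u \<in> pverts G \<and> v \<in> pverts G \<and> u \<noteq> v \<and> (v, u) \<in> parcs G"
  shows "pair_graph G"
proof -
  have "parcs G \<subseteq> pverts G \<times> pverts G" using assms(2) by auto
  then have fin: "finite (parcs G)" using assms(1) by (meson finite_SigmaI finite_subset)
  have "symmetric (with_proj G)"
    unfolding symmetric_def by (auto intro!: symI dest: assms(2))
  then show ?thesis
    using assms fin by unfold_locales (auto dest: assms(2))
qed

lemma pair_graphD:
  assumes "pair_graph G"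
  shows "finite (pverts G)"
    and "(u, v) \<in> parcs G \<Longrightarrow> u \<in> pverts G \<and> v \<in> pverts G \<and> u \<noteq> v \<and> (v, u) \<in> parcs G"
proof -
  interpret pair_graph G by (rule assms)
  show "finite (pverts G)" by (rule pair_finite_verts)
  have "sym (parcs G)" using pair_sym_arcs by (simp add: symmetric_def)
  then show "(u, v) \<in> parcs G \<Longrightarrow> u \<in> pverts G \<and> v \<in> pverts G \<and> u \<noteq> v \<and> (v, u) \<in> parcs G"
    using arc_fst_in_verts arc_snd_in_verts pair_no_loops by (fastforce dest: symD)
qed

lemma pair_graph_products:
  assumes "pair_graph G" and "pair_graph H"
  shows "pair_graph (cartesian_product G H)"
    and "pair_graph (direct_product G H)"
    and "pair_graph (strong_product G H)"
    and "pair_graph (lexicographic_product G H)"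
  by (rule pair_graphI;
      auto simp: cartesian_product_def direct_product_def strong_product_def lexicographic_product_def
        pair_graphD(1)[OF assms(1)] pair_graphD(1)[OF assms(2)]
        dest: pair_graphD(2)[OF assms(1)] pair_graphD(2)[OF assms(2)])+

end

theory Submission
  imports Defs
begin

text \<open>
  An edge open packing \<open>B\<close> contains every edge of the graph between vertices that it covers.
  Given an edge open packing \<open>B\<close> of \<open>G \<circ> H\<close>, let \<open>P\<close> be the projection to \<open>G\<close> of the vertices
  covered by \<open>B\<close>.  The edges of \<open>G\<close> inside \<open>P\<close> lift to \<open>B\<close>, hence form an edge open packing of
  \<open>G\<close>, and the edges of \<open>B\<close> above one of them form a star whose leaves project to an independent
  set of \<open>H\<close>.  If \<open>I\<close> is a maximum independent set of \<open>H\<close>, these edges of \<open>B\<close> may therefore be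
  traded for the copies, at the heights in \<open>I\<close>, of the edges of \<open>G\<close> inside \<open>P\<close>.  The remaining
  edges of \<open>B\<close> lie in fibres over isolated points of \<open>P\<close> and are kept.
\<close>

section \<open>Edges and edge open packings in an arbitrary graph\<close>

lemma pair_graph_arcD:
  assumes "pair_graph G" "(u, v) \<in> parcs G"
  shows "u \<in> pverts G" "v \<in> pverts G" "u \<noteq> v"
  using pair_graphD(2)[OF assms] by simp_all

lemma pair_graph_arc_sym:
  assumes "pair_graph G" "(u, v) \<in> parcs G"
  shows "(v, u) \<in> parcs G"
  using pair_graphD(2)[OF assms] by simp

lemma doubleton_in_uedges_iff:
  assumes "pair_graph G"
  shows "{u, v} \<in> uedges G \<longleftrightarrow> (u, v) \<in> parcs G"
  unfolding uedges_def by (auto simp: doubleton_eq_iff intro: pair_graph_arc_sym[OF assms])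

lemma edge_open_packingD:
  assumes "edge_open_packing G B" "e \<in> B" "f \<in> B" "e \<noteq> f" "u \<in> e" "v \<in> f" "{u, v} \<in> uedges G"
  shows "{u, v} = e \<or> {u, v} = f"
  using assms unfolding edge_open_packing_def by blast

text \<open>If \<open>u\<close> and \<open>v\<close> lie in different edges of \<open>B\<close>, the
  edge uv would join them unless it is one of the two. If they lie in the same edge, that edge is uv
  because there are no loops.\<close>

lemma edge_open_packing_induced:
  assumes G: "pair_graph G" and B: "edge_open_packing G B"
    and "u \<in> \<Union>B" "v \<in> \<Union>B" "(u, v) \<in> parcs G"
  shows "{u, v} \<in> B"
proof -
  obtain e f where ef: "e \<in> B" "u \<in> e" "f \<in> B" "v \<in> f" using assms(3,4) by blast
  have uv: "{u, v} \<in> uedges G" using assms(5) by (simp add: doubleton_in_uedges_iff[OF G])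
  show ?thesis
  proof (cases "e = f")
    case True
    obtain x y where "e = {x, y}"
      using B ef unfolding edge_open_packing_def uedges_def by blast
    moreover have "u \<noteq> v" using pair_graph_arcD(3)[OF G assms(5)] .
    ultimately have "e = {u, v}" using True ef by auto
    then show ?thesis using ef by simp
  next
    case False
    then show ?thesis using edge_open_packingD[OF B ef(1,3) False ef(2,4) uv] ef by auto
  qed
qed

lemma eop_number_mono:
  assumes G: "pair_graph G" and K: "pair_graph K"
    and "\<And>B. edge_open_packing G B \<Longrightarrow> \<exists>B'. edge_open_packing K B' \<and> card B \<le> card B'"
  shows "eop_number G \<le> eop_number K"
  unfolding eop_number_def
proof (rule Max.boundedI[OF finite_eop_cards[OF G] eop_cards_nonempty])
  fix n assume "n \<in> {card B | B. edge_open_packing G B}"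
  then obtain B' where "edge_open_packing K B'" "n \<le> card B'" using assms(3) by blast
  then show "n \<le> Max {card B | B. edge_open_packing K B}"
    using Max_ge[OF finite_eop_cards[OF K]] by (metis (mono_tags, lifting) CollectI le_trans)
qed

section \<open>Independent sets and the packed edges above one edge of \<open>G\<close>\<close>

definition independent_set :: "'a pair_pre_digraph \<Rightarrow> 'a set \<Rightarrow> bool" where
  "independent_set G I \<longleftrightarrow> I \<subseteq> pverts G \<and> (\<forall>x\<in>I. \<forall>y\<in>I. (x, y) \<notin> parcs G)"

lemma maximum_independent_set:
  assumes "pair_graph G"
  obtains I where "independent_set G I" "\<And>J. independent_set G J \<Longrightarrow> card J \<le> card I"
proof -
  have "independent_set G {}" unfolding independent_set_def by simp
  moreover have "\<forall>J. independent_set G J \<longrightarrow> card J < Suc (card (pverts G))"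
    unfolding independent_set_def using pair_graphD(1)[OF assms] by (simp add: card_mono less_Suc_eq_le)
  ultimately show ?thesis using that ex_has_greatest_nat[of "independent_set G" "{}" card] by blast
qed

lemma parcs_strong_product_subset_lexicographic:
  assumes "pair_graph H"
  shows "parcs (strong_product G H) \<subseteq> parcs (lexicographic_product G H)"
  by (auto simp: strong_product_def cartesian_product_def direct_product_def lexicographic_product_def
      dest: pair_graph_arcD[OF assms])

text \<open>Seen as squares of a board, such pairs lie on one line. If \<open>p\<close> and
  \<open>q\<close> differ only in the second coordinate, any member of \<open>R\<close> matches at
  most one of them there, so it shares their first coordinate. Hence one of the two projections is
  injective.\<close>

lemma card_pairwise_agreeing_le:
  assumes "finite R" and agree: "\<And>p q. p \<in> R \<Longrightarrow> q \<in> R \<Longrightarrow> fst p = fst q \<or> snd p = snd q"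
    and "card (fst ` R) \<le> n" "card (snd ` R) \<le> n"
  shows "card R \<le> n"
proof -
  have "inj_on fst R \<or> inj_on snd R"
  proof (rule ccontr)
    assume "\<not> ?thesis"
    then obtain p q p' q' where "p \<in> R" "q \<in> R" "fst p = fst q" "snd p \<noteq> snd q"
      and "p' \<in> R" "q' \<in> R" "snd p' = snd q'" "fst p' \<noteq> fst q'"
      unfolding inj_on_def by (auto simp: prod_eq_iff)
    then show False using agree[of p p'] agree[of p q'] agree[of q p'] agree[of q q'] by metis
  qed
  then show ?thesis using assms(3,4) by (elim disjE) (simp_all add: card_image)
qed

text \<open>Over an edge of \<open>G\<close> the lexicographic product joins every vertex of one
  fibre to every vertex of the other, so two disjoint edges of \<open>B\<close> there would be
  joined crosswise. An arc of \<open>H\<close> between two heights in one fibre would join two edges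
  of \<open>B\<close> vertically. So the pairs of heights agree pairwise in a coordinate, and both
  sets of heights are independent.\<close>

lemma card_packing_fibre_le:
  assumes G: "pair_graph G" and H: "pair_graph H"
    and B: "edge_open_packing (lexicographic_product G H) B"
    and max: "\<And>J. independent_set H J \<Longrightarrow> card J \<le> n"
    and e: "e \<in> uedges G"
  shows "card {f \<in> B. fst ` f = e} \<le> n"
proof -
  define L where "L = lexicographic_product G H"
  have L: "pair_graph L" unfolding L_def using pair_graph_products(4)[OF G H] .
  have BL: "edge_open_packing L B" using B L_def by simp
  obtain a b where e_eq: "e = {a, b}" and ab: "(a, b) \<in> parcs G" using e unfolding uedges_def by blast
  have "a \<noteq> b" using pair_graph_arcD[OF G ab] by blast
  have in_V: "a \<in> pverts G" "b \<in> pverts G" using pair_graph_arcD[OF G ab] by blast+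
  \<comment> \<open>Fixing the orientation from \<open>a\<close> to \<open>b\<close> turns the edges
    above \<open>e\<close> into ordered pairs of heights.\<close>
  define R where "R = {(h, k). {(a, h), (b, k)} \<in> B}"
  have arc: "h \<in> pverts H" "k \<in> pverts H" if "(h, k) \<in> R" for h k
  proof -
    have "{(a, h), (b, k)} \<in> uedges L" using that BL unfolding R_def edge_open_packing_def by blast
    then have "((a, h), (b, k)) \<in> parcs L" by (simp add: doubleton_in_uedges_iff[OF L])
    then have "(a, h) \<in> pverts L" "(b, k) \<in> pverts L" using pair_graph_arcD[OF L] by blast+
    then show "h \<in> pverts H" "k \<in> pverts H" unfolding L_def lexicographic_product_def by simp_all
  qed
  have "R \<subseteq> pverts H \<times> pverts H" using arc by auto
  then have "finite R" using pair_graphD(1)[OF H] by (meson finite_SigmaI finite_subset)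
  have fibre: "{f \<in> B. fst ` f = e} \<subseteq> (\<lambda>(h, k). {(a, h), (b, k)}) ` R"
  proof
    fix f assume f: "f \<in> {f \<in> B. fst ` f = e}"
    then obtain p q where pq: "f = {p, q}" using B unfolding edge_open_packing_def uedges_def by blast
    have "{fst p, fst q} = {a, b}" using f pq e_eq by simp
    then have "(fst p = a \<and> fst q = b) \<or> (fst p = b \<and> fst q = a)" by (simp add: doubleton_eq_iff)
    then have "f = {(a, snd p), (b, snd q)} \<or> f = {(a, snd q), (b, snd p)}"
      using pq by (metis insert_commute prod.collapse)
    then show "f \<in> (\<lambda>(h, k). {(a, h), (b, k)}) ` R" using f unfolding R_def by auto
  qed
  have agree: "h = h' \<or> k = k'" and indep: "(h, h') \<notin> parcs H" "(k, k') \<notin> parcs H"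
    if hk: "(h, k) \<in> R" and hk': "(h', k') \<in> R" for h k h' k'
  proof -
    let ?f = "{(a, h), (b, k)}" and ?f' = "{(a, h'), (b, k')}"
    have fB: "?f \<in> B" "?f' \<in> B" using hk hk' R_def by auto
    have "((a, h), (b, k')) \<in> parcs L"
      using arc hk hk' ab unfolding L_def lexicographic_product_def by auto
    then show "h = h' \<or> k = k'"
      using edge_open_packingD[OF BL fB, of "(a, h)" "(b, k')"] \<open>a \<noteq> b\<close>
      by (auto simp: doubleton_in_uedges_iff[OF L] doubleton_eq_iff)
    show "(h, h') \<notin> parcs H"
    proof
      assume hh: "(h, h') \<in> parcs H"
      then have "h \<noteq> h'" using pair_graph_arcD[OF H] by blast
      moreover have "((a, h), (a, h')) \<in> parcs L"
        using hh in_V unfolding L_def lexicographic_product_def by auto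
      ultimately show False
        using edge_open_packingD[OF BL fB, of "(a, h)" "(a, h')"] \<open>a \<noteq> b\<close>
        by (auto simp: doubleton_in_uedges_iff[OF L] doubleton_eq_iff)
    qed
    show "(k, k') \<notin> parcs H"
    proof
      assume kk: "(k, k') \<in> parcs H"
      then have "k \<noteq> k'" using pair_graph_arcD[OF H] by blast
      moreover have "((b, k), (b, k')) \<in> parcs L"
        using kk in_V unfolding L_def lexicographic_product_def by auto
      ultimately show False
        using edge_open_packingD[OF BL fB, of "(b, k)" "(b, k')"] \<open>a \<noteq> b\<close>
        by (auto simp: doubleton_in_uedges_iff[OF L] doubleton_eq_iff)
    qed
  qed
  have "independent_set H (fst ` R)" "independent_set H (snd ` R)"
    unfolding independent_set_def by (auto dest: arc indep)
  then have "card (fst ` R) \<le> n" "card (snd ` R) \<le> n" using max by blast+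
  moreover have "fst p = fst q \<or> snd p = snd q" if "p \<in> R" "q \<in> R" for p q
    using agree[of "fst p" "snd p" "fst q" "snd q"] that by simp
  ultimately have "card R \<le> n" by (intro card_pairwise_agreeing_le[OF \<open>finite R\<close>])
  moreover have "card {f \<in> B. fst ` f = e} \<le> card R"
    using surj_card_le[OF \<open>finite R\<close> fibre] .
  ultimately show ?thesis by simp
qed

section \<open>The exchange of edges\<close>

lemma edge_open_packing_transfer:
  assumes G: "pair_graph G" and H: "pair_graph H" and K: "pair_graph K"
    and lower: "parcs (cartesian_product G H) \<subseteq> parcs K"
    and upper: "parcs K \<subseteq> parcs (strong_product G H)"
    and B: "edge_open_packing (lexicographic_product G H) B"
  shows "\<exists>B'. edge_open_packing K B' \<and> card B \<le> card B'"
proof -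
  define L where "L = lexicographic_product G H"
  have L: "pair_graph L" unfolding L_def using pair_graph_products(4)[OF G H] .
  have BL: "edge_open_packing L B" using B L_def by simp
  \<comment> \<open>\<open>K\<close> ranges over the graphs between the Cartesian and the strong
    product, so one construction serves both bounds. As \<open>K\<close> lies inside
    \<open>L\<close>, edges kept from \<open>B\<close> cannot become joined in
    \<open>K\<close>.\<close>
  have KL: "parcs K \<subseteq> parcs L"
    using upper parcs_strong_product_subset_lexicographic[OF H] unfolding L_def by blast
  obtain I where I: "independent_set H I" and max: "\<And>J. independent_set H J \<Longrightarrow> card J \<le> card I"
    using maximum_independent_set[OF H] by blast
  define P where "P = fst ` \<Union>B"
  define E where "E = {e \<in> uedges G. e \<subseteq> P}"
  \<comment> \<open>An edge of \<open>L\<close> projects to a single vertex or onto an edge of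
    \<open>G\<close>. The first kind, \<open>B1\<close>, is kept; the second, \<open>B2\<close>, is
    traded for the horizontal copies in \<open>C\<close>.\<close>
  define B1 where "B1 = {f \<in> B. fst ` f \<notin> uedges G}"
  define B2 where "B2 = {f \<in> B. fst ` f \<in> uedges G}"
  define C where "C = (\<lambda>(e, h). e \<times> {h}) ` (E \<times> I)"
  have BU: "B \<subseteq> uedges L" using BL unfolding edge_open_packing_def by simp
  have finB: "finite B" using BU finite_uedges[OF L] finite_subset by blast
  have finE: "finite E" unfolding E_def using finite_uedges[OF G] by simp
  have finI: "finite I" using I pair_graphD(1)[OF H] unfolding independent_set_def
    by (meson finite_subset)
  have coverL: "\<Union>B \<subseteq> pverts L"
    using BU unfolding uedges_def by (fastforce dest: pair_graph_arcD[OF L])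
  have E_cases: "\<exists>a b. e = {a, b} \<and> (a, b) \<in> parcs G \<and> a \<in> P \<and> b \<in> P" if "e \<in> E" for e
    using that unfolding E_def uedges_def by auto
  have join: "{(a, h), (b, k)} \<in> B"
    if "(a, h) \<in> \<Union>B" "(b, k) \<in> \<Union>B" "(a, b) \<in> parcs G" for a b h k
  proof (rule edge_open_packing_induced[OF L BL that(1,2)])
    show "((a, h), (b, k)) \<in> parcs L"
      using that coverL unfolding L_def lexicographic_product_def by auto
  qed

  have E_packing: "edge_open_packing G E"
    unfolding edge_open_packing_def
  proof (intro conjI ballI impI notI)
    show "E \<subseteq> uedges G" unfolding E_def by blast
    fix e f assume e: "e \<in> E" and f: "f \<in> E" and "e \<noteq> f"
      and "\<exists>d\<in>uedges G - {e, f}. \<exists>u\<in>e. \<exists>v\<in>f. d = {u, v}"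
    then obtain u v where uv: "u \<in> e" "v \<in> f" "{u, v} \<in> uedges G" "{u, v} \<noteq> e" "{u, v} \<noteq> f"
      by blast
    \<comment> \<open>Choosing one covered height over each point of \<open>P\<close> gives a
      section that carries the edges in \<open>E\<close> to edges of \<open>B\<close>. A joining
      edge in \<open>G\<close> thus lifts to a joining edge in \<open>L\<close>, and projecting back
      recovers the equality excluded by \<open>uv\<close>.\<close>
    obtain s where s: "\<And>p. p \<in> P \<Longrightarrow> (p, s p) \<in> \<Union>B"
    proof -
      have "\<forall>p\<in>P. \<exists>h. (p, h) \<in> \<Union>B" unfolding P_def by force
      then show ?thesis using that by metis
    qed
    have lift: "(\<lambda>p. (p, s p)) ` d \<in> B" if "d \<in> E" for d
      using E_cases[OF that] join s by auto
    have fst_lift: "fst ` (\<lambda>p. (p, s p)) ` d = d" for d by force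
    have "{u, v} \<in> E" using uv e f unfolding E_def by auto
    then have "(\<lambda>p. (p, s p)) ` {u, v} \<in> B" by (rule lift)
    then have "{(u, s u), (v, s v)} \<in> uedges L" using BU by auto
    moreover have "(\<lambda>p. (p, s p)) ` e \<noteq> (\<lambda>p. (p, s p)) ` f" using \<open>e \<noteq> f\<close> fst_lift by metis
    ultimately have "(\<lambda>p. (p, s p)) ` {u, v} = (\<lambda>p. (p, s p)) ` e \<or>
        (\<lambda>p. (p, s p)) ` {u, v} = (\<lambda>p. (p, s p)) ` f"
      using edge_open_packingD[OF BL lift[OF e] lift[OF f], of "(u, s u)" "(v, s v)"] uv by auto
    then show False using uv fst_lift by metis
  qed

  have B1_cases: "\<exists>g h k. f = {(g, h), (g, k)} \<and> g \<in> pverts G \<and> (h, k) \<in> parcs H" if "f \<in> B1" for f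
  proof -
    have "f \<in> uedges L" using BU that unfolding B1_def by blast
    then obtain p q where pq: "f = {p, q}" "(p, q) \<in> parcs L" unfolding uedges_def by blast
    obtain a h b k where "p = (a, h)" "q = (b, k)" by (cases p, cases q)
    then have f: "f = {(a, h), (b, k)}" "((a, h), (b, k)) \<in> parcs L" using pq by simp_all
    have "(a, b) \<notin> parcs G"
      using that f(1) unfolding B1_def by (simp add: doubleton_in_uedges_iff[OF G])
    then show ?thesis using f unfolding L_def lexicographic_product_def by auto
  qed
  \<comment> \<open>A covered vertex over a neighbour of \<open>g\<close> would be adjacent to both
    ends of the vertical edge \<open>f\<close>. Both connecting edges would lie in \<open>B\<close>,
    and \<open>f\<close> would close a triangle with them.\<close>
  have isolated: "(g, a) \<notin> parcs G" if f: "f \<in> B1" "g \<in> fst ` f" "a \<in> P" for f g a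
  proof
    assume ga: "(g, a) \<in> parcs G"
    obtain h k where fe: "f = {(g, h), (g, k)}" and hk: "(h, k) \<in> parcs H"
      using B1_cases[OF f(1)] f(2) by auto
    obtain x where x: "(a, x) \<in> \<Union>B" using f(3) unfolding P_def by force
    have "f \<in> B" using f unfolding B1_def by simp
    then have "{(g, h), (a, x)} \<in> B" "{(g, k), (a, x)} \<in> B" using join x ga fe by blast+
    moreover have "h \<noteq> k" "g \<noteq> a" using hk ga pair_graph_arcD[OF H] pair_graph_arcD[OF G] by blast+
    moreover have "{(g, h), (g, k)} \<in> uedges L" using \<open>f \<in> B\<close> fe BU by blast
    ultimately show False
      using edge_open_packingD[OF BL, of "{(g, h), (a, x)}" "{(g, k), (a, x)}" "(g, h)" "(g, k)"]
      by (auto simp: doubleton_eq_iff)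
  qed

  have "B1 \<subseteq> uedges K"
  proof
    fix f assume "f \<in> B1"
    then obtain g h k where "f = {(g, h), (g, k)}" "g \<in> pverts G" "(h, k) \<in> parcs H"
      using B1_cases by blast
    then show "f \<in> uedges K" using lower
      by (auto simp: cartesian_product_def doubleton_in_uedges_iff[OF K])
  qed
  moreover have "C \<subseteq> uedges K"
  proof
    fix c assume "c \<in> C"
    then obtain e h where "c = e \<times> {h}" "e \<in> E" "h \<in> I" unfolding C_def by auto
    moreover obtain a b where "e = {a, b}" "(a, b) \<in> parcs G" using E_cases \<open>e \<in> E\<close> by blast
    moreover have "h \<in> pverts H" using I \<open>h \<in> I\<close> unfolding independent_set_def by blast
    ultimately show "c \<in> uedges K" using lower
      by (auto simp: cartesian_product_def doubleton_in_uedges_iff[OF K])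
  qed
  moreover have "{u, v} = e \<or> {u, v} = f"
    if ef: "e \<in> B1 \<union> C" "f \<in> B1 \<union> C" "e \<noteq> f" "u \<in> e" "v \<in> f" and uvK: "{u, v} \<in> uedges K"
    for e f u v
  proof -
    obtain a x b y where uv: "u = (a, x)" "v = (b, y)" by (cases u, cases v) auto
    have arcK: "(u, v) \<in> parcs K" using uvK by (simp add: doubleton_in_uedges_iff[OF K])
    then have arcL: "(u, v) \<in> parcs L" using KL by blast
    have arc_strong: "(u, v) \<in> parcs (strong_product G H)" using arcK upper by blast
    have ab: "(a, b) \<in> parcs G \<or> a = b"
      using arc_strong uv
      by (auto simp: strong_product_def cartesian_product_def direct_product_def)
    have inP: "fst ` c \<subseteq> P" if "c \<in> B1 \<union> C" for c
      using that unfolding B1_def C_def P_def E_def by auto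
    \<comment> \<open>Ends of edges in \<open>C\<close> project to points with a neighbour in
      \<open>P\<close>, those of \<open>B1\<close> to points without one. An edge of
      \<open>K\<close> keeps the first coordinate or moves it along an edge of \<open>G\<close>, so
      none runs between the two kinds.\<close>
    have C_nbr: "\<exists>a'\<in>P. (a, a') \<in> parcs G" if c: "c \<in> C" "a \<in> fst ` c" for c a
    proof -
      have "fst ` c \<in> E" using c(1) unfolding C_def by auto
      then obtain a1 a2 where a12: "fst ` c = {a1, a2}" "(a1, a2) \<in> parcs G" "a1 \<in> P" "a2 \<in> P"
        using E_cases by blast
      then have "(a2, a1) \<in> parcs G" using pair_graph_arc_sym[OF G] by blast
      then show ?thesis using c(2) a12 by auto
    qed
    have ae: "a \<in> fst ` e" "b \<in> fst ` f"
      using imageI[OF ef(4), of fst] imageI[OF ef(5), of fst] uv by simp_all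
    then have aP: "a \<in> P" "b \<in> P" using inP[OF ef(1)] inP[OF ef(2)] by blast+
    consider "e \<in> B1" "f \<in> B1" | "e \<in> B1" "f \<in> C" | "e \<in> C" "f \<in> B1" | "e \<in> C" "f \<in> C"
      using ef by blast
    then show ?thesis
    proof cases
      case 1
      then have "e \<in> B" "f \<in> B" unfolding B1_def by auto
      then show ?thesis
        using edge_open_packingD[OF BL _ _ ef(3-5)] arcL by (simp add: doubleton_in_uedges_iff[OF L])
    next
      case 2
      then show ?thesis using ab isolated[OF 2(1) ae(1)] C_nbr[OF 2(2) ae(2)] aP by blast
    next
      case 3
      have "(b, a) \<in> parcs G \<or> a = b" using ab pair_graph_arc_sym[OF G] by blast
      then show ?thesis using isolated[OF 3(2) ae(2)] C_nbr[OF 3(1) ae(1)] aP by blast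
    next
      case 4
      then obtain d d' where d: "e = d \<times> {x}" "d \<in> E" "x \<in> I" "f = d' \<times> {y}" "d' \<in> E" "y \<in> I"
        using ef uv unfolding C_def by auto
      \<comment> \<open>An arc of the strong product that changes the height follows an arc of
        \<open>H\<close>. Independence of \<open>I\<close> thus leaves only horizontal arcs, and the
        question reduces to the packing \<open>E\<close> of \<open>G\<close>.\<close>
      have "(x, y) \<notin> parcs H" using I d unfolding independent_set_def by blast
      then have "x = y" "(a, b) \<in> parcs G" using arc_strong uv
        by (auto simp: strong_product_def cartesian_product_def direct_product_def)
      moreover have "d \<noteq> d'" using ef(3) d \<open>x = y\<close> by blast
      ultimately have "{a, b} = d \<or> {a, b} = d'"
        using edge_open_packingD[OF E_packing d(2,5), of a b] ef d uv
        by (simp add: doubleton_in_uedges_iff[OF G])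
      then show ?thesis using d uv \<open>x = y\<close> by auto
    qed
  qed
  ultimately have "edge_open_packing K (B1 \<union> C)"
    unfolding edge_open_packing_def by blast

  moreover have "card B \<le> card (B1 \<union> C)"
  proof -
    \<comment> \<open>\<open>B2\<close> splits into the fibres over \<open>E\<close>, each with at
      most \<open>card I\<close> edges, which is the number of copies in \<open>C\<close> of the
      edge below.\<close>
    have "B2 \<subseteq> (\<Union>e\<in>E. {f \<in> B. fst ` f = e})" unfolding B2_def E_def P_def by auto
    moreover have "finite (\<Union>e\<in>E. {f \<in> B. fst ` f = e})" using finE finB by simp
    ultimately have "card B2 \<le> card (\<Union>e\<in>E. {f \<in> B. fst ` f = e})" by (rule card_mono[rotated])
    also have "\<dots> \<le> (\<Sum>e\<in>E. card {f \<in> B. fst ` f = e})" by (rule card_UN_le[OF finE])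
    also have "\<dots> \<le> card E * card I"
      using sum_bounded_above[of E "\<lambda>e. card {f \<in> B. fst ` f = e}" "card I"]
        card_packing_fibre_le[OF G H B max] unfolding E_def by simp
    also have "\<dots> = card C"
    proof -
      \<comment> \<open>Nonemptiness lets \<open>e \<times> {h}\<close> determine both
        \<open>e\<close> and \<open>h\<close>.\<close>
      have "e \<noteq> {}" if "e \<in> E" for e using E_cases[OF that] by blast
      then have "inj_on (\<lambda>(e, h). e \<times> {h}) (E \<times> I)" by (auto simp: inj_on_def times_eq_iff)
      then show ?thesis unfolding C_def by (simp add: card_image card_cartesian_product)
    qed
    finally have "card B2 \<le> card C" .
    moreover have "B1 \<inter> C = {}"
    proof -
      have "fst ` c \<in> uedges G" if "c \<in> C" for c using that unfolding C_def E_def by auto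
      then show ?thesis unfolding B1_def by blast
    qed
    moreover have "finite B1" "finite B2" "finite C" "B = B1 \<union> B2" "B1 \<inter> B2 = {}"
      using finB finE finI unfolding B1_def B2_def C_def by auto
    ultimately show ?thesis by (simp add: card_Un_disjoint)
  qed
  ultimately show ?thesis by blast
qed

theorem proposition5p2:
  fixes G :: "'a pair_pre_digraph" and H :: "'b pair_pre_digraph"
  assumes "pair_graph G" and "pair_graph H"
  shows "eop_number (lexicographic_product G H)
    \<le> min (eop_number (strong_product G H)) (eop_number (cartesian_product G H))"
proof -
  note products = pair_graph_products[OF assms]
  have transfer: "eop_number (lexicographic_product G H) \<le> eop_number K"
    if "pair_graph K" "parcs (cartesian_product G H) \<subseteq> parcs K"
      "parcs K \<subseteq> parcs (strong_product G H)" for K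
    by (rule eop_number_mono[OF products(4) that(1)],
        rule edge_open_packing_transfer[OF assms that])
  show ?thesis
    by (rule min.boundedI; rule transfer) (use products in \<open>simp_all add: strong_product_def\<close>)
qed

end
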